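(* For every integer $n\ge 0$ we have $$xF_{n+1}(x,y,t\,|\,\alpha)=A^{\mathrm{cyc}}_{n+1}(x,y,t\,|\,\alpha)+\alpha(x-t)A^{\mathrm{cyc}}_n(x,y,t\,|\,\alpha),$$ where $A_0^{\mathrm{cyc}}(x,y,t\,|\,\alpha)=1$, and, as formal power series in $z$, $$\sum_{n\ge 0}F_{n+1}(x,y,t\,|\,\alpha)\frac{z^n}{n!}=\alpha e^{(y-t)z}\left(\frac{(x-y)e^{tz}}{xe^{yz}-ye^{xz}}\right)^{1+\alpha}.$$
   Context: $\mathfrak{S}_n$ is the symmetric group on $[n]$. For $\sigma\in\mathfrak{S}_n$, $\mathrm{exc}(\sigma),\mathrm{drop}(\sigma),\mathrm{fix}(\sigma)$ are the numbers of $i\in[n]$ with $\sigma(i)>i$, $\sigma(i)<i$, $\sigma(i)=i$ respectively; $\mathrm{cyc}(\sigma)$ is the number of cycles (fixed points included); $\widehat{\mathrm{exc}}(\sigma)$ and $\widehat{\mathrm{fix}}(\sigma)$ are the numbers of $i\in\{2,\dots,n\}$ with $\sigma(i)>i$ and $\sigma(i)=i$ respectively. Define $$A_n^{\mathrm{cyc}}(x,y,t\,|\,\alpha)=\sum_{\sigma\in\mathfrak{S}_n}x^{\mathrm{exc}(\sigma)}y^{\mathrm{drop}(\sigma)}t^{\mathrm{fix}(\sigma)}\alpha^{\mathrm{cyc}(\sigma)},\qquad F_n(x,y,t\,|\,\alpha)=\sum_{\sigma\in\mathfrak{S}_n}x^{\widehat{\mathrm{exc}}(\sigma)}y^{\mathrm{drop}(\sigma)}t^{\widehat{\mathrm{fix}}(\sigma)}\alpha^{\mathrm{cyc}(\sigma)}.$$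 The quotient $\frac{x-y}{xe^{yz}-ye^{xz}}$ is understood as a formal power series in $z$ with constant term $1$ (after cancelling $x-y$), and for such a series $S$, $S^{c}=\exp(c\log S)$. *)

theory Defs
  imports "HOL-Computational_Algebra.Formal_Power_Series" "HOL-Combinatorics.Orbits"
begin

text \<open>
  The weights \<open>x\<close>, \<open>y\<close>, \<open>t\<close>, \<open>\<alpha>\<close> are arbitrary elements of an arbitrary field of characteristic 0.
  This includes the indeterminates of a rational function field over the rationals,
  so an identity for all such weights is the same as the polynomial identity.
\<close>

definition exc :: "nat \<Rightarrow> (nat \<Rightarrow> nat) \<Rightarrow> nat" where
  "exc n \<sigma> = card {i \<in> {1..n}. \<sigma> i > i}"

definition drops :: "nat \<Rightarrow> (nat \<Rightarrow> nat) \<Rightarrow> nat" where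
  "drops n \<sigma> = card {i \<in> {1..n}. \<sigma> i < i}"

definition fixs :: "nat \<Rightarrow> (nat \<Rightarrow> nat) \<Rightarrow> nat" where
  "fixs n \<sigma> = card {i \<in> {1..n}. \<sigma> i = i}"

definition exc_hat :: "nat \<Rightarrow> (nat \<Rightarrow> nat) \<Rightarrow> nat" where
  "exc_hat n \<sigma> = card {i \<in> {2..n}. \<sigma> i > i}"

definition fix_hat :: "nat \<Rightarrow> (nat \<Rightarrow> nat) \<Rightarrow> nat" where
  "fix_hat n \<sigma> = card {i \<in> {2..n}. \<sigma> i = i}"

definition cyc :: "nat \<Rightarrow> (nat \<Rightarrow> nat) \<Rightarrow> nat" where
  "cyc n \<sigma> = card (orbit \<sigma> ` {1..n})"

definition A_cyc :: "nat \<Rightarrow> 'a \<Rightarrow> 'a \<Rightarrow> 'a \<Rightarrow> 'a \<Rightarrow> 'a::field_char_0" where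
  "A_cyc n x y t \<alpha> =
    (\<Sum>\<sigma> | \<sigma> permutes {1..n}. x ^ exc n \<sigma> * y ^ drops n \<sigma> * t ^ fixs n \<sigma> * \<alpha> ^ cyc n \<sigma>)"

definition F_hat :: "nat \<Rightarrow> 'a \<Rightarrow> 'a \<Rightarrow> 'a \<Rightarrow> 'a \<Rightarrow> 'a::field_char_0" where
  "F_hat n x y t \<alpha> =
    (\<Sum>\<sigma> | \<sigma> permutes {1..n}.
       x ^ exc_hat n \<sigma> * y ^ drops n \<sigma> * t ^ fix_hat n \<sigma> * \<alpha> ^ cyc n \<sigma>)"

lemma A_cyc_0: "A_cyc 0 x y t \<alpha> = 1"
proof -
  have "{\<sigma>. \<sigma> permutes {1..0::nat}} = {id}" by auto
  then show ?thesis
    by (simp add: A_cyc_def exc_def drops_def fixs_def cyc_def)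
qed

text \<open>
  The quotient of \<open>x exp(y z) - y exp(x z)\<close> by \<open>x - y\<close>. Its coefficient at \<open>z ^ n / n!\<close> is
  \<open>(x y ^ n - y x ^ n) / (x - y)\<close>, written here with the factor \<open>x - y\<close> cancelled so that it is
  also meaningful for \<open>x = y\<close>. For \<open>n = 1\<close> the sum is empty.
\<close>

definition cancelled_denom :: "'a \<Rightarrow> 'a \<Rightarrow> 'a::field_char_0 fps" where
  "cancelled_denom x y = Abs_fps (\<lambda>n. if n = 0 then 1
     else - x * y * (\<Sum>i<n - 1. x ^ i * y ^ (n - 2 - i)) / fact n)"

definition eulerian_quotient :: "'a \<Rightarrow> 'a \<Rightarrow> 'a::field_char_0 fps" where
  "eulerian_quotient x y = inverse (cancelled_denom x y)"

lemma cancelled_denom: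
  fixes x y :: "'a::field_char_0"
  shows "fps_const (x - y) * cancelled_denom x y
    = fps_const x * fps_exp y - fps_const y * fps_exp x"
proof (rule fps_ext)
  fix n
  consider "n = 0" | "n = 1" | m where "n = Suc (Suc m)"
    by (metis One_nat_def not0_implies_Suc)
  then show "fps_nth (fps_const (x - y) * cancelled_denom x y) n
      = fps_nth (fps_const x * fps_exp y - fps_const y * fps_exp x) n"
  proof cases
    case 3
    have "x * y ^ n - y * x ^ n = - (x * y) * (x ^ Suc m - y ^ Suc m)"
      using 3 by (simp add: algebra_simps)
    also have "x ^ Suc m - y ^ Suc m = (x - y) * (\<Sum>i<Suc m. x ^ i * y ^ (m - i))"
      by (subst power_diff_sumr2) (simp add: mult.commute)
    finally have eq: "x * y ^ n - y * x ^ n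
        = (x - y) * (- x * y * (\<Sum>i<n - 1. x ^ i * y ^ (n - 2 - i)))"
      using 3 by (simp add: mult_ac del: sum.lessThan_Suc)
    have "fps_nth (fps_const (x - y) * cancelled_denom x y) n
        = (x - y) * (- x * y * (\<Sum>i<n - 1. x ^ i * y ^ (n - 2 - i))) / fact n"
      using 3 by (simp add: cancelled_denom_def del: sum.lessThan_Suc fact_Suc fps_const_sub)
    also have "\<dots> = (x * y ^ n - y * x ^ n) / fact n"
      by (simp only: eq)
    also have "\<dots> = fps_nth (fps_const x * fps_exp y - fps_const y * fps_exp x) n"
      by (simp add: diff_divide_distrib)
    finally show ?thesis .
  qed (simp_all add: cancelled_denom_def)
qed

lemma eulerian_quotient_nth_0: "fps_nth (eulerian_quotient x y) 0 = 1"
  by (simp add: eulerian_quotient_def cancelled_denom_def)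

lemma eulerian_quotient_eq_divide:
  fixes x y :: "'a::field_char_0"
  assumes "x \<noteq> y"
  shows "eulerian_quotient x y
    = fps_const (x - y) / (fps_const x * fps_exp y - fps_const y * fps_exp x)"
proof -
  let ?D = "fps_const x * fps_exp y - fps_const y * fps_exp x"
  have D0: "fps_nth ?D 0 \<noteq> 0" using assms by simp
  have c0: "fps_nth (cancelled_denom x y) 0 \<noteq> 0" by (simp add: cancelled_denom_def)
  have "fps_const (x - y) / ?D = fps_const (x - y) * inverse ?D"
    using D0 by (rule fps_divide_unit)
  also have "\<dots> = fps_const (x - y) * inverse (fps_const (x - y)) * inverse (cancelled_denom x y)"
    by (simp add: cancelled_denom[symmetric] fps_inverse_mult del: fps_const_sub)
  also have "fps_const (x - y) * inverse (fps_const (x - y)) = 1"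
    using assms by (simp add: fps_const_inverse del: fps_const_sub)
  finally show ?thesis by (simp add: eulerian_quotient_def)
qed

text \<open>
  Here \<open>fps_ln 1\<close> is the series of \<open>log (1 + z)\<close>. Both functions are meaningful only for
  series \<open>S\<close> with constant term 1.
\<close>

definition fps_log :: "'a::field_char_0 fps \<Rightarrow> 'a fps" where
  "fps_log S = fps_ln 1 oo (S - 1)"

definition fps_cpow :: "'a::field_char_0 fps \<Rightarrow> 'a \<Rightarrow> 'a fps" where
  "fps_cpow S c = fps_exp 1 oo (fps_const c * fps_log S)"

end

theory Submission
  imports Defs
begin

text \<open>
  The proof builds the permutations by inserting a new largest element, and turns this into a
  differential equation.

  Call a pair \<open>(i, \<sigma> i)\<close> an edge of \<open>\<sigma>\<close>; it weighs \<open>x\<close>, \<open>y\<close> or \<open>t\<close> according to whether it is an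
  excedance, a drop or a fixed point. A new largest element \<open>a\<close> enters a permutation either as a
  fixed point, which multiplies the weight by \<open>\<alpha> t\<close>, or by subdividing an edge \<open>i \<rightarrow> \<sigma> i\<close> into
  \<open>i \<rightarrow> a \<rightarrow> \<sigma> i\<close>, which replaces the weight of that edge by \<open>x y\<close>, whatever it was, and keeps the
  number of cycles. So insertion acts on weight polynomials as multiplication by \<open>\<alpha> t\<close> plus the
  derivation that sends \<open>x\<close>, \<open>y\<close>, \<open>t\<close> to \<open>x y\<close>. In \<open>F\<close> the edge out of \<open>1\<close> weighs \<open>1\<close> instead;
  subdividing it creates the weight \<open>y\<close>, so here the operator has the further summand \<open>y\<close>.

  This derivation is realised by \<open>d/dz\<close> on power series: let \<open>u\<close>, \<open>v\<close>, \<open>w\<close> be series with constant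
  terms \<open>x\<close>, \<open>y\<close>, \<open>t\<close> and \<open>u' = v' = w' = u v\<close>. If \<open>f' = (\<alpha> w + v) f\<close>, then by induction the \<open>n\<close>-th
  derivative of \<open>\<alpha> f\<close> is \<open>f\<close> times the weight sum \<open>F\<^sub>n\<^sub>+\<^sub>1\<close> taken at \<open>u\<close>, \<open>v\<close>, \<open>w\<close>
  (\<open>higher_deriv_marked_sum\<close>), so with \<open>f(0) = 1\<close> the exponential generating function of
  \<open>F\<^sub>n\<^sub>+\<^sub>1\<close> is \<open>\<alpha> f\<close>. With \<open>Q\<close> the Eulerian quotient, the system is solved by
  \<open>u = x exp(y z) Q\<close>, \<open>v = y exp(x z) Q\<close>, \<open>w = t + v - y\<close>; and as \<open>Q' = (v - y) Q\<close>, the series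
  \<open>exp((y - t) z) (exp(t z) Q)\<^sup>1\<^sup>+\<^sup>\<alpha>\<close> has the logarithmic derivative required of \<open>f\<close>.

  The relation between \<open>F\<close> and \<open>A\<close> is a comparison of the edge out of \<open>1\<close>. If \<open>\<sigma> 1 > 1\<close>, this edge
  contributes \<open>x\<close> to the weight in \<open>A\<close> and \<open>1\<close> to that in \<open>F\<close>; if \<open>\<sigma> 1 = 1\<close>, it contributes \<open>t\<close>
  and \<open>1\<close>. Hence \<open>x F - A\<close> is \<open>x - t\<close> times the weight sum, as in \<open>F\<close>, over the permutations that
  fix \<open>1\<close>. These are the permutations of \<open>{2..n+1}\<close> with one more cycle, so this sum is \<open>\<alpha> A\<^sub>n\<close>.
\<close>

section \<open>Cycles under insertion of a new element\<close>

lemma permutes_self_in_orbit: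
  assumes "finite S" "p permutes S"
  shows "x \<in> orbit p x"
proof (rule permutation_self_in_orbit)
  show "permutation p"
    unfolding permutation_permutes using assms by (intro exI[of _ S]) simp
qed

lemma permutes_orbit_eq:
  assumes "finite S" "p permutes S" "x \<in> orbit p y"
  shows "orbit p x = orbit p y"
proof
  have "y \<in> orbit p x"
    using permutes_self_in_orbit[OF assms(1,2)] assms(3) by (rule orbit_swap)
  then show "orbit p y \<subseteq> orbit p x"
    by (auto intro: orbit_trans)
  show "orbit p x \<subseteq> orbit p y"
    using assms(3) by (auto intro: orbit_trans)
qed

lemma card_orbits_insert_fixed:
  assumes "finite S" "p permutes S" "a \<notin> S"
  shows "card (orbit p ` insert a S) = Suc (card (orbit p ` S))"
proof -
  have "p a = a"
    using assms permutes_not_in by metis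
  then have "orbit p a = {a}"
    by (simp add: orbit_eq_singleton_iff)
  moreover have "orbit p s \<subseteq> S" if "s \<in> S" for s
    using assms that permutes_orbit_subset by metis
  ultimately have "orbit p a \<notin> orbit p ` S"
    using assms(3) by auto
  then show ?thesis
    using assms(1) by simp
qed

text \<open>
  The permutation \<open>transpose a b \<circ> p\<close> follows \<open>p\<close>, except that it visits \<open>a\<close> immediately before
  \<open>b\<close>. So its orbits are those of \<open>p\<close>, one of them enlarged by \<open>a\<close>, and intersecting with \<open>S\<close>
  recovers the orbits of \<open>p\<close>.
\<close>

lemma card_orbits_insert_before:
  assumes fin: "finite S" and p: "p permutes S" and a: "a \<notin> S" and b: "b \<in> S"
  shows "card (orbit (transpose a b \<circ> p) ` insert a S) = card (orbit p ` S)"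
proof -
  define q where "q = transpose a b \<circ> p"
  have pa: "p a = a"
    using p a permutes_not_in by metis
  have q_perm: "q permutes insert a S"
    unfolding q_def using p b
    by (auto intro: permutes_compose permutes_swap_id permutes_subset[of p S])
  note q_eq = permutes_orbit_eq[OF _ q_perm] and q_self = permutes_self_in_orbit[OF _ q_perm]
  have qa: "q a = b"
    using pa by (simp add: q_def)
  have qb: "q z = a" if "p z = b" for z
    using that by (simp add: q_def)
  have q_other: "q z = p z" if "p z \<noteq> b" "z \<in> S" for z
    using that p a by (metis comp_apply permutes_in_image q_def transpose_apply_other)
  have pS: "orbit p x \<subseteq> S" if "x \<in> S" for x
    using p that permutes_orbit_subset by metis
  have p_step: "p z \<in> orbit q z" if "z \<in> S" for z
  proof (cases "p z = b")
    case True
    have "q (q z) \<in> orbit q z"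
      by (intro orbit.intros)
    then show ?thesis
      using True qa qb[OF True] by simp
  next
    case False
    then show ?thesis
      using q_other[OF False that] orbit.base[of q z] by simp
  qed
  have sub1: "y \<in> orbit q x" if "y \<in> orbit p x" "x \<in> S" for x y
    using that(1)
  proof induction
    case base
    then show ?case using p_step that by blast
  next
    case (step y)
    then show ?case
      using p_step[of y] pS[OF that(2)] by (blast intro: orbit_trans)
  qed
  \<comment> \<open>In the converse direction a visit to \<open>a\<close> is charged to the visit to \<open>b\<close> that follows it.\<close>
  have sub2: "(if y = a then b else y) \<in> orbit p x" if "y \<in> orbit q x" "x \<in> S" for x y
    using that(1)
  proof induction
    case base
    show ?case
      using q_other[OF _ that(2)] qb[of x] orbit.base[of p x] pS[OF that(2)] a
      by (cases "p x = b") auto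
  next
    case (step y)
    show ?case
    proof (cases "y = a")
      case True
      then show ?thesis
        using step.IH qa a b by auto
    next
      case False
      then have y: "y \<in> orbit p x" "y \<in> S"
        using step.IH pS[OF that(2)] by auto
      then have "p y \<in> orbit p x"
        by (blast intro: orbit.step)
      then show ?thesis
        using q_other[OF _ y(2)] qb[of y] pS[OF that(2)] a
        by (cases "p y = b") auto
    qed
  qed
  have inter: "orbit q x \<inter> S = orbit p x" if "x \<in> S" for x
  proof
    show "orbit q x \<inter> S \<subseteq> orbit p x"
      using sub2[OF _ that] a by (metis IntE subsetI)
    show "orbit p x \<subseteq> orbit q x \<inter> S"
      using sub1[OF _ that] pS[OF that] by blast
  qed
  have "orbit q a = orbit q b"
    using fin qa q_eq[of b a] orbit.base[of q a] by simp
  then have "orbit q ` insert a S = orbit q ` S"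
    using b by auto
  moreover have "(\<lambda>C. C \<inter> S) ` orbit q ` S = orbit p ` S"
    using inter by (simp add: image_image)
  moreover have "inj_on (\<lambda>C. C \<inter> S) (orbit q ` S)"
  proof (rule inj_onI, clarify)
    fix x y assume "x \<in> S" "y \<in> S" and eq: "orbit q x \<inter> S = orbit q y \<inter> S"
    then have "x \<in> orbit q y"
      using q_self fin by blast
    then show "orbit q x = orbit q y"
      using q_eq fin by simp
  qed
  ultimately show ?thesis
    unfolding q_def[symmetric] by (metis card_image)
qed

section \<open>Weight sums over permutations\<close>

definition edge_weight :: "'a \<Rightarrow> 'a \<Rightarrow> 'a \<Rightarrow> nat \<Rightarrow> nat \<Rightarrow> 'a" where
  "edge_weight u v w i j = (if j > i then u else if j < i then v else w)"

text \<open>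
  Edges that start in the marked set \<open>M\<close> weigh \<open>1\<close>. With \<open>M = {}\<close> this is the sum defining \<open>A\<close>,
  with \<open>M = {1}\<close> the one defining \<open>F\<close>. The weights range over any commutative ring, because they
  will be power series as well as scalars.
\<close>

definition marked_sum ::
    "nat set \<Rightarrow> nat set \<Rightarrow> 'a \<Rightarrow> 'a \<Rightarrow> 'a \<Rightarrow> 'a \<Rightarrow> 'a::comm_ring_1" where
  "marked_sum M S u v w \<alpha> =
    (\<Sum>\<sigma> | \<sigma> permutes S. \<alpha> ^ card (orbit \<sigma> ` S) * (\<Prod>i\<in>S - M. edge_weight u v w i (\<sigma> i)))"

lemma prod_edge_weight:
  fixes u v w :: "'a::comm_ring_1"
  assumes "finite S"
  shows "(\<Prod>i\<in>S. edge_weight u v w i (\<sigma> i))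
    = u ^ card {i \<in> S. \<sigma> i > i} * v ^ card {i \<in> S. \<sigma> i < i} * w ^ card {i \<in> S. \<sigma> i = i}"
  using assms
proof induction
  case (insert a S)
  have *: "{i \<in> insert a S. P i} = (if P a then insert a {i \<in> S. P i} else {i \<in> S. P i})"
    for P by auto
  consider "\<sigma> a > a" | "\<sigma> a < a" | "\<sigma> a = a"
    by linarith
  then show ?case
    by cases (use insert in \<open>simp_all add: * edge_weight_def mult_ac del: insert_iff\<close>)
qed simp

lemma A_cyc_eq_marked_sum: "A_cyc n x y t \<alpha> = marked_sum {} {1..n} x y t \<alpha>"
  by (simp add: A_cyc_def marked_sum_def prod_edge_weight exc_def drops_def fixs_def cyc_def mult_ac)

lemma F_hat_eq_marked_sum: "F_hat n x y t \<alpha> = marked_sum {1} {1..n} x y t \<alpha>"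
  unfolding F_hat_def marked_sum_def
proof (rule sum.cong[OF refl], clarify)
  fix \<sigma> assume \<sigma>: "\<sigma> permutes {1..n}"
  \<comment> \<open>The statistic \<open>drops\<close> ranges over \<open>1\<close> as well, but \<open>1\<close> is never a drop.\<close>
  have "\<sigma> 1 \<ge> 1"
    using permutes_in_image[OF \<sigma>, of 1] permutes_not_in[OF \<sigma>, of 1]
    by (metis atLeastAtMost_iff order_refl)
  then have not_1: "\<sigma> i < i \<Longrightarrow> i \<noteq> 1" for i
    by auto
  have "i \<in> {1..n} \<and> \<sigma> i < i \<longleftrightarrow> i \<in> {2..n} \<and> \<sigma> i < i" for i
    using not_1[of i] by auto
  then have "{i \<in> {1..n}. \<sigma> i < i} = {i \<in> {2..n}. \<sigma> i < i}"
    by simp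
  moreover have "{1..n} - {1} = {2..n}"
    by auto
  ultimately show "x ^ exc_hat n \<sigma> * y ^ drops n \<sigma> * t ^ fix_hat n \<sigma> * \<alpha> ^ cyc n \<sigma>
      = \<alpha> ^ card (orbit \<sigma> ` {1..n}) * (\<Prod>i\<in>{1..n} - {1}. edge_weight x y t i (\<sigma> i))"
    by (simp add: prod_edge_weight exc_hat_def drops_def fix_hat_def cyc_def mult_ac)
qed

lemma marked_sum_empty: "marked_sum {} {} u v w \<alpha> = 1"
  by (simp add: marked_sum_def)

lemma marked_sum_singleton: "marked_sum {a} {a} u v w \<alpha> = \<alpha>"
  by (simp add: marked_sum_def)

text \<open>
  This is the insertion step: the first summand inserts \<open>a\<close> as a fixed point, the summand for \<open>i\<close>
  subdivides the edge out of \<open>i\<close>. The part from \<open>i\<close> to \<open>a\<close> inherits the mark of \<open>i\<close>, and the part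
  that leaves \<open>a\<close> is always an unmarked drop.
\<close>

lemma marked_sum_insert:
  fixes u v w \<alpha> :: "'a::comm_ring_1"
  assumes fin: "finite S" and M: "M \<subseteq> S" and max: "\<And>s. s \<in> S \<Longrightarrow> s < a"
  shows "marked_sum M (insert a S) u v w \<alpha> = \<alpha> * w * marked_sum M S u v w \<alpha>
    + (\<Sum>\<sigma> | \<sigma> permutes S. \<alpha> ^ card (orbit \<sigma> ` S) *
        (\<Sum>i\<in>S. v * ((if i \<in> M then 1 else u) *
          (\<Prod>j\<in>S - M - {i}. edge_weight u v w j (\<sigma> j)))))"
proof -
  have aS: "a \<notin> S"
    using max by blast
  have diff: "insert a S - M = insert a (S - M)"
    using aS M by auto
  define W where "W \<sigma> = \<alpha> ^ card (orbit \<sigma> ` insert a S)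
    * (\<Prod>i\<in>insert a S - M. edge_weight u v w i (\<sigma> i))" for \<sigma>
  have fixed: "W (transpose a a \<circ> p)
      = \<alpha> * w * (\<alpha> ^ card (orbit p ` S) * (\<Prod>i\<in>S - M. edge_weight u v w i (p i)))"
    if p: "p permutes S" for p
  proof -
    have "p a = a"
      using p aS permutes_not_in by metis
    then show ?thesis
      using fin aS card_orbits_insert_fixed[OF fin p aS]
      by (simp add: W_def diff edge_weight_def mult_ac del: image_insert)
  qed
  have subdivided: "W (transpose a (p i) \<circ> p) = \<alpha> ^ card (orbit p ` S) *
      (v * ((if i \<in> M then 1 else u) * (\<Prod>j\<in>S - M - {i}. edge_weight u v w j (p j))))"
    if p: "p permutes S" and i: "i \<in> S" for p i
  proof -
    let ?q = "transpose a (p i) \<circ> p"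
    have pa: "p a = a"
      using p aS permutes_not_in by metis
    have pi: "p i \<in> S"
      using p i permutes_in_image by metis
    have q: "?q j = p j" if "j \<in> S" "j \<noteq> i" for j
      using that p aS i
      by (metis comp_apply permutes_in_image permutes_inj inj_eq transpose_apply_other)
    have rest: "(\<Prod>j\<in>S - M - {i}. edge_weight u v w j (?q j))
        = (\<Prod>j\<in>S - M - {i}. edge_weight u v w j (p j))"
      by (rule prod.cong[OF refl]) (metis DiffE q singletonI)
    have "(\<Prod>j\<in>S - M. edge_weight u v w j (?q j))
        = (if i \<in> M then 1 else u) * (\<Prod>j\<in>S - M - {i}. edge_weight u v w j (?q j))"
    proof (cases "i \<in> M")
      case True
      then have "S - M - {i} = S - M"
        by auto
      then show ?thesis
        using True by simp
    next
      case False
      then show ?thesis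
        using i fin max[OF i]
        by (subst prod.remove[of _ i]) (auto simp: edge_weight_def)
    qed
    moreover have "edge_weight u v w a (?q a) = v"
      using pa max[OF pi] by (simp add: edge_weight_def)
    ultimately show ?thesis
      using fin aS card_orbits_insert_before[OF fin p aS pi]
      by (simp add: W_def diff rest del: image_insert comp_apply)
  qed
  \<comment> \<open>The target \<open>b\<close> of the subdivided edge is replaced as summation index by its source.\<close>
  have reindex: "(\<Sum>b\<in>S. W (transpose a b \<circ> p)) = (\<Sum>i\<in>S. W (transpose a (p i) \<circ> p))"
    if "p permutes S" for p
    using sum.permute[OF that, of "\<lambda>b. W (transpose a b \<circ> p)"] by (simp add: o_def)
  have "marked_sum M (insert a S) u v w \<alpha>
      = (\<Sum>b\<in>insert a S. \<Sum>p | p permutes S. W (transpose a b \<circ> p))"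
    unfolding marked_sum_def W_def[symmetric]
    by (rule sum_over_permutations_insert[OF fin aS])
  also have "\<dots> = (\<Sum>p | p permutes S. W (transpose a a \<circ> p))
      + (\<Sum>p | p permutes S. \<Sum>b\<in>S. W (transpose a b \<circ> p))"
    using fin aS by (simp add: sum.swap[of _ S])
  also have "(\<Sum>p | p permutes S. W (transpose a a \<circ> p)) = \<alpha> * w * marked_sum M S u v w \<alpha>"
    unfolding marked_sum_def sum_distrib_left
    by (rule sum.cong[OF refl], rule fixed) simp
  also have "(\<Sum>p | p permutes S. \<Sum>b\<in>S. W (transpose a b \<circ> p))
      = (\<Sum>p | p permutes S. \<alpha> ^ card (orbit p ` S) *
        (\<Sum>i\<in>S. v * ((if i \<in> M then 1 else u) *
          (\<Prod>j\<in>S - M - {i}. edge_weight u v w j (p j)))))"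
    unfolding sum_distrib_left[of "_ ^ _"]
    by (rule sum.cong[OF refl]) (simp add: reindex subdivided del: transpose_apply_first)
  finally show ?thesis .
qed

section \<open>Insertion as differentiation\<close>

lemma fps_deriv_prod:
  fixes f :: "'b \<Rightarrow> 'a::comm_ring_1 fps"
  shows "fps_deriv (prod f A) = (\<Sum>i\<in>A. fps_deriv (f i) * prod f (A - {i}))"
proof (induction A rule: infinite_finite_induct)
  case (insert a A)
  have "prod f (insert a A - {i}) = f a * prod f (A - {i})" if "i \<in> A" for i
  proof -
    have "insert a A - {i} = insert a (A - {i})"
      using insert that by auto
    then show ?thesis
      using insert by simp
  qed
  then show ?case
    using insert by (simp add: sum_distrib_left mult_ac)
qed simp_all

text \<open>
  If \<open>d/dz\<close> sends each of the three edge weights to \<open>u v\<close>, then differentiating a product of edge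
  weights subdivides each unmarked edge in turn. The factor \<open>f\<close> accounts for the other insertions:
  \<open>\<alpha> w\<close> for the new fixed point and one \<open>v\<close> for each marked edge.
\<close>

lemma deriv_marked_sum:
  fixes u v w f :: "'a::field_char_0 fps"
  assumes fin: "finite S" and M: "M \<subseteq> S" and max: "\<And>s. s \<in> S \<Longrightarrow> s < a"
    and du: "fps_deriv u = u * v" and dv: "fps_deriv v = u * v" and dw: "fps_deriv w = u * v"
    and df: "fps_deriv f = (fps_const \<alpha> * w + of_nat (card M) * v) * f"
  shows "fps_deriv (f * marked_sum M S u v w (fps_const \<alpha>))
    = f * marked_sum M (insert a S) u v w (fps_const \<alpha>)"
proof -
  define c where "c \<sigma> = fps_const \<alpha> ^ card (orbit \<sigma> ` S)" for \<sigma> :: "nat \<Rightarrow> nat"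
  define P where "P \<sigma> = (\<Prod>i\<in>S - M. edge_weight u v w i (\<sigma> i))" for \<sigma>
  define R where "R \<sigma> i = (\<Prod>j\<in>S - M - {i}. edge_weight u v w j (\<sigma> j))" for \<sigma> i
  have "fps_deriv (edge_weight u v w i j) = u * v" for i j
    by (simp add: edge_weight_def du dv dw)
  then have dP: "fps_deriv (P \<sigma>) = (\<Sum>i\<in>S - M. u * v * R \<sigma> i)" for \<sigma>
    by (simp add: P_def R_def fps_deriv_prod)
  have dc: "fps_deriv (c \<sigma>) = 0" for \<sigma>
    by (simp add: c_def)
  have subdivide: "(\<Sum>i\<in>S. v * ((if i \<in> M then 1 else u) * R \<sigma> i))
      = of_nat (card M) * v * P \<sigma> + fps_deriv (P \<sigma>)" for \<sigma>
  proof -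
    have "R \<sigma> i = P \<sigma>" if "i \<in> M" for i
      using that by (simp add: R_def P_def)
    then show ?thesis
      using fin M by (simp add: sum.subset_diff[OF M fin] dP mult_ac)
  qed
  have T: "marked_sum M S u v w (fps_const \<alpha>) = (\<Sum>\<sigma> | \<sigma> permutes S. c \<sigma> * P \<sigma>)"
    by (simp add: marked_sum_def c_def P_def)
  have "marked_sum M (insert a S) u v w (fps_const \<alpha>)
      = fps_const \<alpha> * w * marked_sum M S u v w (fps_const \<alpha>)
      + (\<Sum>\<sigma> | \<sigma> permutes S. c \<sigma> * (\<Sum>i\<in>S. v * ((if i \<in> M then 1 else u) * R \<sigma> i)))"
    unfolding c_def R_def using fin M max by (rule marked_sum_insert)
  also have "\<dots> = (fps_const \<alpha> * w + of_nat (card M) * v) * (\<Sum>\<sigma> | \<sigma> permutes S. c \<sigma> * P \<sigma>)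
      + fps_deriv (\<Sum>\<sigma> | \<sigma> permutes S. c \<sigma> * P \<sigma>)"
    unfolding T subdivide
    by (simp add: fps_deriv_sum dc distrib_left distrib_right sum.distrib sum_distrib_left mult_ac)
  finally show ?thesis
    by (simp add: df T algebra_simps)
qed

lemma nth_0_marked_sum:
  "fps_nth (marked_sum M S u v w \<alpha>) 0
    = marked_sum M S (fps_nth u 0) (fps_nth v 0) (fps_nth w 0) (fps_nth \<alpha> 0)"
proof -
  have "fps_nth (edge_weight u v w i j) 0
      = edge_weight (fps_nth u 0) (fps_nth v 0) (fps_nth w 0) i j" for i j
    by (simp add: edge_weight_def)
  moreover have "fps_nth (prod g A) 0 = (\<Prod>i\<in>A. fps_nth (g i) 0)"
    for g :: "nat \<Rightarrow> 'a fps" and A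
    by (induction A rule: infinite_finite_induct) auto
  ultimately show ?thesis
    by (simp add: marked_sum_def fps_sum_nth fps_power_zeroth)
qed

text \<open>
  Taylor's formula: \<open>n\<close> insertions are \<open>n\<close> differentiations, and at \<open>z = 0\<close> the series become scalar
  weights.
\<close>

lemma higher_deriv_marked_sum:
  fixes u v w f :: "'a::field_char_0 fps"
  assumes "fps_deriv u = u * v" "fps_deriv v = u * v" "fps_deriv w = u * v"
    and "fps_deriv f = (fps_const \<alpha> * w + of_nat (card M) * v) * f" and f0: "fps_nth f 0 = 1"
    and M: "M \<subseteq> {k..<m}" and km: "k \<le> m"
  shows "marked_sum M {k..<m + n} (fps_nth u 0) (fps_nth v 0) (fps_nth w 0) \<alpha>
    = fact n * fps_nth (f * marked_sum M {k..<m} u v w (fps_const \<alpha>)) n"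
proof -
  have "(fps_deriv ^^ n) (f * marked_sum M {k..<m} u v w (fps_const \<alpha>))
      = f * marked_sum M {k..<m + n} u v w (fps_const \<alpha>)"
  proof (induction n)
    case (Suc n)
    have "{k..<m + Suc n} = insert (m + n) {k..<m + n}"
      using km by auto
    moreover have "M \<subseteq> {k..<m + n}"
      using M by auto
    ultimately show ?case
      using Suc deriv_marked_sum[of "{k..<m + n}" M "m + n" u v w f \<alpha>] assms by simp
  qed simp
  then show ?thesis
    using f0 by (simp add: fps_0th_higher_deriv[symmetric] nth_0_marked_sum)
qed

section \<open>Solving the differential equations\<close>

text \<open>
  Multiplied by \<open>x - y\<close>, this is the derivative of \<open>x exp(y z) - y exp(x z)\<close>. Comparing
  coefficients covers \<open>x = y\<close> too; there the identity is a recurrence of complete homogeneous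
  symmetric polynomials.
\<close>

lemma cancelled_denom_deriv:
  fixes x y :: "'a::field_char_0"
  shows "fps_deriv (cancelled_denom x y)
    = fps_const y * cancelled_denom x y - fps_const y * fps_exp x"
proof (rule fps_ext)
  fix n
  show "fps_nth (fps_deriv (cancelled_denom x y)) n
    = fps_nth (fps_const y * cancelled_denom x y - fps_const y * fps_exp x) n"
  proof (cases n)
    case 0
    then show ?thesis
      by (simp add: cancelled_denom_def)
  next
    case (Suc m)
    \<comment> \<open>the complete homogeneous symmetric polynomial of degree \<open>k - 1\<close> in \<open>x\<close> and \<open>y\<close>\<close>
    define h where "h k = (\<Sum>i<k. x ^ i * y ^ (k - 1 - i))" for k
    have h_Suc: "h (Suc m) = y * h m + x ^ m"
    proof -
      have "(\<Sum>i<m. x ^ i * y ^ (m - i)) = y * h m"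
        unfolding h_def sum_distrib_left
      proof (rule sum.cong[OF refl])
        fix i assume "i \<in> {..<m}"
        then have "m - i = Suc (m - 1 - i)"
          by auto
        then show "x ^ i * y ^ (m - i) = y * (x ^ i * y ^ (m - 1 - i))"
          by simp
      qed
      then show ?thesis
        by (simp add: h_def)
    qed
    have D: "fps_nth (cancelled_denom x y) (Suc k) = - x * y * h k / fact (Suc k)" for k
      by (simp add: cancelled_denom_def h_def)
    have "fps_nth (fps_deriv (cancelled_denom x y)) n = - x * y * h (Suc m) / fact (Suc m)"
      unfolding Suc by (simp add: D fact_Suc[of "Suc m"] del: fact_Suc of_nat_Suc)
    also have "\<dots> = y * (- x * y * h m / fact (Suc m)) - y * (x ^ Suc m / fact (Suc m))"
      by (simp add: h_Suc field_simps del: fact_Suc)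
    finally show ?thesis
      unfolding Suc by (simp add: D del: fact_Suc)
  qed
qed

lemma eulerian_quotient_commute: "eulerian_quotient x y = eulerian_quotient y x"
proof -
  have "(\<Sum>i<n - 1. x ^ i * y ^ (n - 2 - i)) = (\<Sum>i<n - 1. y ^ i * x ^ (n - 2 - i))" for n
  proof (subst sum.nat_diff_reindex[symmetric], rule sum.cong[OF refl])
    fix i assume "i \<in> {..<n - 1}"
    then have "n - 1 - Suc i = n - 2 - i" "n - 2 - (n - 2 - i) = i"
      by auto
    then show "x ^ (n - 1 - Suc i) * y ^ (n - 2 - (n - 1 - Suc i)) = y ^ i * x ^ (n - 2 - i)"
      by (simp only: mult.commute)
  qed
  moreover have "- x * y = - y * x"
    by simp
  ultimately show ?thesis
    by (simp only: eulerian_quotient_def cancelled_denom_def)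
qed

text \<open>
  The pair \<open>u = weight_series x y\<close>, \<open>v = weight_series y x\<close> is the solution of \<open>u' = v' = u v\<close> with
  \<open>u(0) = x\<close>, \<open>v(0) = y\<close>. It is found from two observations: \<open>u - v = x - y\<close> is constant, and
  \<open>u / v\<close> has logarithmic derivative \<open>v - u = y - x\<close>, so that \<open>u / v = (x / y) exp((y - x) z)\<close>.
\<close>

definition weight_series :: "'a \<Rightarrow> 'a \<Rightarrow> 'a::field_char_0 fps" where
  "weight_series x y = fps_const x * fps_exp y * eulerian_quotient x y"

lemma weight_series_nth_0: "fps_nth (weight_series x y) 0 = x"
  by (simp add: weight_series_def eulerian_quotient_nth_0)

lemma eulerian_quotient_deriv:
  fixes x y :: "'a::field_char_0"
  shows "fps_deriv (eulerian_quotient x y)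
    = (weight_series y x - fps_const y) * eulerian_quotient x y"
proof -
  have c: "fps_nth (cancelled_denom x y) 0 \<noteq> 0"
    by (simp add: cancelled_denom_def)
  have "inverse (cancelled_denom x y) * cancelled_denom x y = 1"
    using c by (rule inverse_mult_eq_1)
  then have "cancelled_denom x y * inverse (cancelled_denom x y) ^ 2 = inverse (cancelled_denom x y)"
    by (metis mult.assoc mult.commute mult_1 power2_eq_square)
  then show ?thesis
    unfolding weight_series_def eulerian_quotient_commute[of y x]
    unfolding eulerian_quotient_def fps_inverse_deriv[OF c] cancelled_denom_deriv
    by (simp add: algebra_simps power2_eq_square)
qed

lemma weight_series_deriv:
  "fps_deriv (weight_series x y) = weight_series x y * weight_series y x"
proof -
  have "fps_deriv (weight_series x y) = fps_const x * (fps_const y * fps_exp y) * eulerian_quotient x y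
      + fps_const x * fps_exp y * ((weight_series y x - fps_const y) * eulerian_quotient x y)"
    unfolding weight_series_def[of x y] by (simp add: eulerian_quotient_deriv algebra_simps)
  also have "\<dots> = weight_series x y * weight_series y x"
    unfolding weight_series_def[of x y] by (simp add: algebra_simps)
  finally show ?thesis .
qed

lemma fps_cpow_nth_0 [simp]: "fps_nth (fps_cpow S c) 0 = 1"
  by (simp add: fps_cpow_def)

lemma fps_deriv_cpow:
  fixes S :: "'a::field_char_0 fps"
  assumes S0: "fps_nth S 0 = 1" and dS: "fps_deriv S = L * S"
  shows "fps_deriv (fps_cpow S c) = fps_const c * L * fps_cpow S c"
proof -
  have nz: "fps_nth (S - 1) 0 = 0"
    using S0 by simp
  have "(1 + fps_X) oo (S - 1) = S"
    using nz by (simp add: fps_compose_add_distrib)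
  then have inv: "inverse (1 + fps_X) oo (S - 1) = inverse S"
    using nz by (subst fps_inverse_compose) auto
  have "fps_deriv (fps_log S) = inverse S * (L * S)"
    unfolding fps_log_def fps_compose_deriv[OF nz] fps_ln_deriv
    using inv dS by simp
  also have "\<dots> = L"
    using S0 inverse_mult_eq_1[of S] by (simp add: mult_ac)
  finally have dlog: "fps_deriv (fps_log S) = L" .
  have "fps_nth (fps_const c * fps_log S) 0 = 0"
    by (simp add: fps_log_def fps_ln_def)
  from fps_compose_deriv[OF this, of "fps_exp 1"] show ?thesis
    by (simp add: fps_cpow_def dlog mult_ac)
qed

lemma exp_eulerian_quotient_cpow_deriv:
  "fps_deriv (fps_cpow (fps_exp t * eulerian_quotient x y) c)
    = fps_const c * (fps_const t + weight_series y x - fps_const y)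
      * fps_cpow (fps_exp t * eulerian_quotient x y) c"
proof (rule fps_deriv_cpow)
  show "fps_nth (fps_exp t * eulerian_quotient x y) 0 = 1"
    by (simp add: eulerian_quotient_nth_0)
  show "fps_deriv (fps_exp t * eulerian_quotient x y)
      = (fps_const t + weight_series y x - fps_const y) * (fps_exp t * eulerian_quotient x y)"
    by (simp add: eulerian_quotient_deriv algebra_simps)
qed

text \<open>
  Both sides are the \<open>n\<close>-th derivative at \<open>0\<close> of \<open>(exp(t z) Q)\<^sup>\<alpha>\<close>, since the labels enter the
  insertion step only through their order.
\<close>

lemma A_cyc_eq_marked_sum_from_2:
  "A_cyc n x y t \<alpha> = marked_sum {} {2..n + 1} x y t \<alpha>"
proof -
  let ?f = "fps_cpow (fps_exp t * eulerian_quotient x y) \<alpha>"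
  have "marked_sum {} {k..<k + n} x y t \<alpha> = fact n * fps_nth ?f n" for k
    using higher_deriv_marked_sum[of "weight_series x y" "weight_series y x"
        "fps_const t + weight_series y x - fps_const y" ?f \<alpha> "{}" k k n]
    by (simp add: marked_sum_empty weight_series_nth_0 weight_series_deriv
        exp_eulerian_quotient_cpow_deriv mult.commute)
  from this[of 1] this[of 2] show ?thesis
    by (simp add: A_cyc_eq_marked_sum atLeastLessThanSuc_atLeastAtMost)
qed

lemma F_hat_egf:
  "F_hat (n + 1) x y t \<alpha> = fact n * (\<alpha> * fps_nth
    (fps_exp (y - t) * fps_cpow (fps_exp t * eulerian_quotient x y) (1 + \<alpha>)) n)"
proof -
  let ?u = "weight_series x y" and ?v = "weight_series y x"
  let ?w = "fps_const t + ?v - fps_const y"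
  let ?S = "fps_exp t * eulerian_quotient x y"
  let ?f = "fps_exp (y - t) * fps_cpow ?S (1 + \<alpha>)"
  have scalars: "fps_const (1 + \<alpha>) = 1 + fps_const \<alpha>" "fps_const (y - t) = fps_const y - fps_const t"
    by (simp_all flip: fps_const_add)
  \<comment> \<open>The exponent \<open>1 + \<alpha>\<close> contributes \<open>(1 + \<alpha>) w\<close> to the logarithmic derivative, and
    \<open>w + (y - t) = v\<close>.\<close>
  have df: "fps_deriv ?f = (fps_const \<alpha> * ?w + ?v) * ?f"
    unfolding fps_deriv_mult fps_exp_deriv exp_eulerian_quotient_cpow_deriv scalars
    by (simp add: algebra_simps del: fps_const_sub fps_const_add fps_const_mult)
  have "{1..<2} = {1::nat}"
    by auto
  then have "marked_sum {1} {1..<2 + n} x y t \<alpha> = fact n * fps_nth (?f * fps_const \<alpha>) n"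
    using higher_deriv_marked_sum[of ?u ?v ?w ?f \<alpha> "{1}" 1 2 n] df
    by (simp add: marked_sum_singleton weight_series_nth_0 weight_series_deriv mult.commute)
  then show ?thesis
    by (simp add: F_hat_eq_marked_sum atLeastLessThanSuc_atLeastAtMost mult_ac)
qed

section \<open>The edge out of the smallest element\<close>

lemma mult_F_hat_eq:
  fixes x y t \<alpha> :: "'a::field_char_0"
  shows "x * F_hat (n + 1) x y t \<alpha> = A_cyc (n + 1) x y t \<alpha> + \<alpha> * (x - t) * A_cyc n x y t \<alpha>"
proof -
  let ?S = "{1..n + 1}" and ?T = "{2..n + 1}"
  define W where "W \<sigma> = \<alpha> ^ card (orbit \<sigma> ` ?S) * (\<Prod>i\<in>?T. edge_weight x y t i (\<sigma> i))" for \<sigma>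
  have T: "?S - {1} = ?T" "?S = insert 1 ?T"
    by auto
  have "\<sigma> permutes ?S \<and> \<sigma> 1 = 1 \<longleftrightarrow> \<sigma> permutes ?T" for \<sigma>
  proof
    assume "\<sigma> permutes ?S \<and> \<sigma> 1 = 1"
    moreover have "i = 1" if "i \<in> ?S - ?T" for i
      using that by auto
    ultimately show "\<sigma> permutes ?T"
      by (metis permutes_superset)
  next
    assume "\<sigma> permutes ?T"
    then show "\<sigma> permutes ?S \<and> \<sigma> 1 = 1"
      by (auto intro: permutes_subset simp: permutes_not_in)
  qed
  then have perms: "{\<sigma> \<in> {\<sigma>. \<sigma> permutes ?S}. \<sigma> 1 = 1} = {\<sigma>. \<sigma> permutes ?T}"
    by simp
  have F: "F_hat (n + 1) x y t \<alpha> = (\<Sum>\<sigma> | \<sigma> permutes ?S. W \<sigma>)"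
    unfolding F_hat_eq_marked_sum marked_sum_def W_def T(1) ..
  have "A_cyc (n + 1) x y t \<alpha> = (\<Sum>\<sigma> | \<sigma> permutes ?S. (if \<sigma> 1 = 1 then t else x) * W \<sigma>)"
    unfolding A_cyc_eq_marked_sum marked_sum_def
  proof (rule sum.cong[OF refl], clarify)
    fix \<sigma> assume \<sigma>: "\<sigma> permutes ?S"
    then have "\<sigma> 1 \<ge> 1"
      using permutes_in_image[OF \<sigma>, of 1] by simp
    then have "edge_weight x y t 1 (\<sigma> 1) = (if \<sigma> 1 = 1 then t else x)"
      by (auto simp: edge_weight_def)
    moreover have "(\<Prod>i\<in>?S - {}. edge_weight x y t i (\<sigma> i))
        = edge_weight x y t 1 (\<sigma> 1) * (\<Prod>i\<in>?T. edge_weight x y t i (\<sigma> i))"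
      unfolding T(2) by simp
    ultimately show "\<alpha> ^ card (orbit \<sigma> ` ?S) * (\<Prod>i\<in>?S - {}. edge_weight x y t i (\<sigma> i))
        = (if \<sigma> 1 = 1 then t else x) * W \<sigma>"
      by (simp only: W_def mult_ac)
  qed
  then have "x * F_hat (n + 1) x y t \<alpha> - A_cyc (n + 1) x y t \<alpha>
      = (\<Sum>\<sigma> | \<sigma> permutes ?S. if \<sigma> 1 = 1 then (x - t) * W \<sigma> else 0)"
    unfolding F sum_distrib_left
    by (simp only: sum_subtractf[symmetric]) (rule sum.cong, auto simp: algebra_simps)
  also have "\<dots> = (\<Sum>\<sigma> | \<sigma> permutes ?T. (x - t) * W \<sigma>)"
    unfolding perms[symmetric]
    by (rule sum.inter_filter[symmetric]) (simp add: finite_permutations)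
  also have "\<dots> = \<alpha> * (x - t) * marked_sum {} ?T x y t \<alpha>"
    unfolding marked_sum_def sum_distrib_left
  proof (rule sum.cong[OF refl], clarify)
    fix \<sigma> assume "\<sigma> permutes ?T"
    then have "card (orbit \<sigma> ` ?S) = Suc (card (orbit \<sigma> ` ?T))"
      unfolding T(2) by (intro card_orbits_insert_fixed) auto
    then show "(x - t) * W \<sigma> = \<alpha> * (x - t) *
        (\<alpha> ^ card (orbit \<sigma> ` ?T) * (\<Prod>i\<in>?T - {}. edge_weight x y t i (\<sigma> i)))"
      by (simp add: W_def mult_ac)
  qed
  finally show ?thesis
    unfolding A_cyc_eq_marked_sum_from_2[of n] by (simp add: algebra_simps)
qed

theorem theorem5p2:
  fixes x y t \<alpha> :: "'a::field_char_0"
  shows "(\<forall>n. x * F_hat (n + 1) x y t \<alpha>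
              = A_cyc (n + 1) x y t \<alpha> + \<alpha> * (x - t) * A_cyc n x y t \<alpha>)
    \<and> A_cyc 0 x y t \<alpha> = 1
    \<and> Abs_fps (\<lambda>n. F_hat (n + 1) x y t \<alpha> / fact n)
        = fps_const \<alpha> * fps_exp (y - t) * fps_cpow (fps_exp t * eulerian_quotient x y) (1 + \<alpha>)"
proof (intro conjI allI)
  show "Abs_fps (\<lambda>n. F_hat (n + 1) x y t \<alpha> / fact n)
      = fps_const \<alpha> * fps_exp (y - t) * fps_cpow (fps_exp t * eulerian_quotient x y) (1 + \<alpha>)"
    by (rule fps_ext) (simp add: F_hat_egf mult.assoc del: One_nat_def)
qed (rule mult_F_hat_eq, rule A_cyc_0)

end
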